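(* Let $a,b$ be positive integers with $1\le a<b$, and let $G$ be a finite simple graph with minimum degree $\delta(G)\geq a+2$. If $G-\{x,y\}$ has an $[a,b]$-factor for every pair of distinct vertices $x,y\in V(G)$, then $G-e$ has an $[a,b]$-factor for every edge $e\in E(G)$.
   Context: A spanning subgraph $H$ of $G$ is an $[a,b]$-factor if $a\le d_H(x)\le b$ for every $x\in V(G)$. $G-e$ denotes $G$ with the edge $e$ removed (all vertices kept). *)

theory Defs
  imports Main
begin

record 'a ugraph =
  verts :: "'a set"
  edges :: "'a set set"

definition finite_simple_graph :: "'a ugraph \<Rightarrow> bool" where
  "finite_simple_graph G \<longleftrightarrow>
     finite (verts G) \<and> (\<forall>e\<in>edges G. e \<subseteq> verts G \<and> card e = 2)"

definition degree :: "'a ugraph \<Rightarrow> 'a \<Rightarrow> nat" where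
  "degree G v = card {e \<in> edges G. v \<in> e}"

(* Unspecified for the graph without vertices. *)
definition min_degree :: "'a ugraph \<Rightarrow> nat" where
  "min_degree G = Min (degree G ` verts G)"

definition delete_verts :: "'a ugraph \<Rightarrow> 'a set \<Rightarrow> 'a ugraph" where
  "delete_verts G X = \<lparr>verts = verts G - X, edges = {e \<in> edges G. e \<inter> X = {}}\<rparr>"

definition delete_edge :: "'a ugraph \<Rightarrow> 'a set \<Rightarrow> 'a ugraph" where
  "delete_edge G e = \<lparr>verts = verts G, edges = edges G - {e}\<rparr>"

definition spanning_subgraph :: "'a ugraph \<Rightarrow> 'a ugraph \<Rightarrow> bool" where
  "spanning_subgraph H G \<longleftrightarrow> verts H = verts G \<and> edges H \<subseteq> edges G"

definition is_factor :: "nat \<Rightarrow> nat \<Rightarrow> 'a ugraph \<Rightarrow> 'a ugraph \<Rightarrow> bool" where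
  "is_factor a b H G \<longleftrightarrow>
     spanning_subgraph H G \<and> (\<forall>x\<in>verts G. a \<le> degree H x \<and> degree H x \<le> b)"

definition has_factor :: "nat \<Rightarrow> nat \<Rightarrow> 'a ugraph \<Rightarrow> bool" where
  "has_factor a b G \<longleftrightarrow> (\<exists>H. is_factor a b H G)"

end

theory Submission
  imports Defs
begin

text \<open>For \<open>a < b\<close> there is a parity-free version of Lovasz's factor theorem: if \<open>G\<close> has no
  \<open>[a,b]\<close>-factor, then there are disjoint \<open>S, T\<close> with
  \<open>b |S| + (\<Sum>t\<in>T. d\<^bsub>G-S\<^esub>(t)) < a |T|\<close>, obtained by alternating paths from a deficient vertex of an
  optimal subgraph. Apply it to \<open>G - e\<close>. Some \<open>t \<in> T\<close> has fewer than \<open>a\<close> neighbours outside \<open>S\<close>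
  but at least \<open>a + 1\<close> in total, so \<open>S\<close> contains two vertices \<open>x \<noteq> y\<close>. Passing to \<open>G - {x, y}\<close> and
  \<open>S - {x, y}\<close> lowers the left-hand side by \<open>2b\<close> and restoring \<open>e\<close> raises it by at most \<open>2\<close>, so the
  inequality survives and contradicts the factor of \<open>G - {x, y}\<close>.\<close>

section \<open>Neighbourhoods and degrees\<close>

text \<open>Degrees become sizes of vertex sets, so edges into \<open>S\<close> and away from
  \<open>S\<close> can be separated by \<open>\<inter> S\<close> and \<open>- S\<close>. For
  \<open>t\<close> outside \<open>S\<close>, \<open>card (nbrs F t - S)\<close> is the degree of
  \<open>t\<close> once \<open>S\<close> is deleted.\<close>

definition nbrs :: "'a set set \<Rightarrow> 'a \<Rightarrow> 'a set" where
  "nbrs F v = {w. {v, w} \<in> F}"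

lemma finite_nbrs:
  assumes "finite F"
  shows "finite (nbrs F v)"
proof -
  have "inj (\<lambda>w. {v, w})"
    by (auto simp: inj_def doubleton_eq_iff)
  then have "finite ((\<lambda>w. {v, w}) -` F)"
    using assms by (rule finite_vimageI[rotated])
  then show ?thesis
    by (simp add: nbrs_def vimage_def)
qed

lemma card_incident_eq_card_nbrs:
  assumes "\<And>e. e \<in> F \<Longrightarrow> card e = 2"
  shows "card {e \<in> F. v \<in> e} = card (nbrs F v)"
proof -
  have "{e \<in> F. v \<in> e} = (\<lambda>w. {v, w}) ` nbrs F v"
  proof (intro equalityI subsetI)
    fix e assume "e \<in> {e \<in> F. v \<in> e}"
    then have e: "e \<in> F" "v \<in> e" by auto
    then obtain x y where "e = {x, y}"
      using assms[of e] by (auto simp: card_2_iff)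
    then show "e \<in> (\<lambda>w. {v, w}) ` nbrs F v"
      using e by (auto simp: nbrs_def insert_commute)
  qed (auto simp: nbrs_def)
  moreover have "inj_on (\<lambda>w. {v, w}) (nbrs F v)"
    by (auto simp: inj_on_def doubleton_eq_iff)
  ultimately show ?thesis
    by (simp add: card_image)
qed

lemma card_nbrs_insert:
  assumes "finite F" "{s, t} \<notin> F" "s \<noteq> t"
  shows "card (nbrs (insert {s, t} F) v) = card (nbrs F v) + (if v = s \<or> v = t then 1 else 0)"
proof -
  have "nbrs (insert {s, t} F) v =
      (if v = s then insert t (nbrs F v) else if v = t then insert s (nbrs F v) else nbrs F v)"
    using assms(3) by (auto simp: nbrs_def doubleton_eq_iff)
  moreover have "t \<notin> nbrs F s" "s \<notin> nbrs F t"
    using assms(2) by (auto simp: nbrs_def insert_commute)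
  ultimately show ?thesis
    using finite_nbrs[OF assms(1)] by auto
qed

lemma card_nbrs_remove:
  assumes "finite F" "{s, t} \<in> F" "s \<noteq> t"
  shows "card (nbrs F v) = card (nbrs (F - {{s, t}}) v) + (if v = s \<or> v = t then 1 else 0)"
  using card_nbrs_insert[of "F - {{s, t}}" s t v] assms by (simp add: insert_absorb)

section \<open>Alternating walks and augmentation\<close>

text \<open>Ends of the walks of length \<open>n\<close> from \<open>r\<close> whose edges lie alternately outside and inside \<open>H\<close>.\<close>

fun alt_level :: "'a set set \<Rightarrow> 'a set set \<Rightarrow> 'a \<Rightarrow> nat \<Rightarrow> 'a set" where
  "alt_level E H r 0 = {r}"
| "alt_level E H r (Suc n) =
     {w. \<exists>u \<in> alt_level E H r n. {u, w} \<in> (if even n then E - H else H)}"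

text \<open>Instead of augmenting along a whole path, toggle only its last edge: this makes the
  preceding vertex of the path an endpoint of an augmenting path for the new subgraph.\<close>

lemma alternating_augment:
  fixes a b :: nat
  assumes "finite E" "\<And>e. e \<in> E \<Longrightarrow> card e = 2" "a < b"
    and "H \<subseteq> E" "\<And>v. card (nbrs H v) \<le> b" "card (nbrs H r) < a"
    and "v \<in> alt_level E H r n"
    and "if even n then a < card (nbrs H v) else card (nbrs H v) < b"
  shows "\<exists>H' \<subseteq> E. (\<forall>v. card (nbrs H' v) \<le> b)
    \<and> (\<forall>v. min a (card (nbrs H v)) \<le> min a (card (nbrs H' v)))
    \<and> (\<exists>v. min a (card (nbrs H v)) < min a (card (nbrs H' v)))"
  using assms(4-)
proof (induction n arbitrary: H v rule: less_induct)
  case (less n)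
  let ?d = "\<lambda>H v. card (nbrs H v)"
  show ?case
  \<comment> \<open>If an earlier level already holds a suitable endpoint, induction applies to the
    same \<open>H\<close>. Otherwise \<open>n\<close> is minimal: earlier even levels have degrees
    at most \<open>a\<close>, earlier odd levels at least \<open>b\<close>.\<close>
  proof (cases "\<exists>j<n. \<exists>w\<in>alt_level E H r j. if even j then a < ?d H w else ?d H w < b")
    case True
    then show ?thesis
      using less.IH[OF _ less.prems(1-3)] by blast
  next
    case False
    have low_even: "?d H w \<le> a" if "j < n" "w \<in> alt_level E H r j" "even j" for j w
      using False that by (meson not_le)
    have low_odd: "?d H w \<ge> b" if "j < n" "w \<in> alt_level E H r j" "odd j" for j w
      using False that by (meson not_le)
    \<comment> \<open>Level 0 contains only \<open>r\<close>, whose degree is below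
      \<open>a\<close>, so \<open>n\<close> is positive.\<close>
    obtain m where n: "n = Suc m"
      using less.prems by (cases n) auto
    obtain u where u: "u \<in> alt_level E H r m" "{u, v} \<in> (if even m then E - H else H)"
      using less.prems(4) n by auto
    have "u \<noteq> v"
      using u(2) less.prems(1) assms(2)[of "{u, v}"] by (auto split: if_splits)
    have finH: "finite H"
      using less.prems(1) assms(1) finite_subset by blast
    define H1 where "H1 = (if even m then insert {u, v} H else H - {{u, v}})"
    have H1: "H1 \<subseteq> E"
      using u(2) less.prems(1) by (auto simp: H1_def split: if_splits)
    \<comment> \<open>Walks up to level \<open>m\<close> survive the toggle. If one used
      \<open>{u, v}\<close>, its step would have the parity of \<open>m\<close>. Ending in
      \<open>v\<close>, it would put \<open>v\<close> on an earlier level of the parity of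
      \<open>n\<close>, against minimality; ending in \<open>u\<close>, it would put
      \<open>u\<close> on levels of both parities, forcing \<open>b \<le> a\<close>.\<close>
    have levels: "j \<le> m \<Longrightarrow> alt_level E H r j \<subseteq> alt_level E H1 r j" for j
    proof (induction j)
      case (Suc j)
      show ?case
      proof
        fix w assume w: "w \<in> alt_level E H r (Suc j)"
        then obtain x where x: "x \<in> alt_level E H r j"
          "{x, w} \<in> (if even j then E - H else H)" by auto
        have "{x, w} \<noteq> {u, v}"
        proof
          assume eq: "{x, w} = {u, v}"
          then have par: "even j \<longleftrightarrow> even m"
            using x(2) u(2) by (auto split: if_splits)
          from eq consider "w = v" | "w = u" by (auto simp: doubleton_eq_iff)
          then show False
          proof cases
            case 1
            then show False
              using w par low_even[of "Suc j" v] low_odd[of "Suc j" v] less.prems(5) Suc.prems n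
              by (auto split: if_splits)
          next
            case 2
            then show False
              using w par low_even[of "Suc j" u] low_odd[of "Suc j" u] low_even[of m u]
                low_odd[of m u] u(1) assms(3) Suc.prems n
              by (cases "even m") auto
          qed
        qed
        then have "{x, w} \<in> (if even j then E - H1 else H1)"
          using x(2) by (auto simp: H1_def split: if_splits)
        moreover have "x \<in> alt_level E H1 r j"
          using x(1) Suc by auto
        ultimately show "w \<in> alt_level E H1 r (Suc j)" by auto
      qed
    qed simp
    have u1: "u \<in> alt_level E H1 r m"
      using levels u(1) by blast
    show ?thesis
    proof (cases "even m")
      case True
      have d1: "?d H1 w = ?d H w + (if w = u \<or> w = v then 1 else 0)" for w
        using card_nbrs_insert[OF finH _ \<open>u \<noteq> v\<close>] u(2) True by (simp add: H1_def)
      have du: "?d H u \<le> a"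
        using low_even[of m u] u(1) n True by simp
      have dv: "?d H v < b"
        using less.prems(5) n True by simp
      have b1: "?d H1 w \<le> b" for w
        using d1[of w] du dv assms(3) less.prems(2)[of w] by auto
      \<comment> \<open>Adding \<open>{u, v}\<close> is a gain if an end is below \<open>a\<close>.
        Otherwise \<open>u\<close> has degree exactly \<open>a\<close> and rises to
        \<open>a + 1\<close>, so it is an endpoint for \<open>H1\<close> on the even level
        \<open>m\<close>; \<open>r\<close> is neither end and stays deficient.\<close>
      show ?thesis
      proof (cases "?d H u < a \<or> ?d H v < a")
        case True
        then have "min a (?d H u) < min a (?d H1 u) \<or> min a (?d H v) < min a (?d H1 v)"
          using d1[of u] d1[of v] by auto
        then have "\<exists>w. min a (?d H w) < min a (?d H1 w)" by blast
        then show ?thesis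
          using H1 b1 d1 by (intro exI[of _ H1]) auto
      next
        case False
        then have "min a (?d H1 w) = min a (?d H w)" for w
          using d1[of w] by auto
        moreover have "?d H1 r < a"
          using False d1[of r] less.prems(3) by auto
        moreover have "a < ?d H1 u"
          using False d1[of u] by auto
        ultimately show ?thesis
          using less.IH[of m H1 u] n H1 b1 u1 \<open>even m\<close> by simp
      qed
    next
      case False
      have d1: "?d H w = ?d H1 w + (if w = u \<or> w = v then 1 else 0)" for w
        using card_nbrs_remove[OF finH _ \<open>u \<noteq> v\<close>] u(2) False by (simp add: H1_def)
      have du: "b \<le> ?d H u"
        using low_odd[of m u] u(1) n False by simp
      have dv: "a < ?d H v"
        using less.prems(5) n False by simp
      have b1: "?d H1 w \<le> b" for w
        using d1[of w] less.prems(2)[of w] by auto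
      \<comment> \<open>Removing \<open>{u, v}\<close> lowers degrees that exceed \<open>a\<close>,
        since \<open>a < b \<le> card (nbrs H u)\<close>, so no capped degree changes. Now
        \<open>u\<close> has room below \<open>b\<close> and is an endpoint on the odd level
        \<open>m\<close>.\<close>
      have "min a (?d H1 w) = min a (?d H w)" for w
        using d1[of w] du dv assms(3) by auto
      moreover have "?d H1 r < a"
        using d1[of r] less.prems(3) by auto
      moreover have "?d H1 u < b"
        using d1[of u] less.prems(2)[of u] by auto
      ultimately show ?thesis
        using less.IH[of m H1 u] n H1 b1 u1 False by simp
    qed
  qed
qed

section \<open>Both directions of the barrier criterion\<close>

lemma sum_card_nbrs_swap:
  assumes "finite S" "finite T"
  shows "(\<Sum>t\<in>T. card (nbrs F t \<inter> S)) = (\<Sum>s\<in>S. card (nbrs F s \<inter> T))"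
proof -
  have *: "card (nbrs F x \<inter> A) = (\<Sum>y\<in>A. if {x, y} \<in> F then 1 else 0)"
    if "finite A" for x :: 'a and A
    using that by (simp add: sum.If_cases Int_def nbrs_def conj_commute)
  show ?thesis
    using assms by (simp add: * insert_commute sum.swap[of _ S T])
qed

lemma card_nbrs_split:
  assumes "finite F"
  shows "card (nbrs F v) = card (nbrs F v \<inter> S) + card (nbrs F v - S)"
  by (metis assms card_Int_Diff finite_nbrs)

lemma degree_eq_card_nbrs:
  assumes "\<And>e. e \<in> edges G \<Longrightarrow> card e = 2"
  shows "degree G v = card (nbrs (edges G) v)"
  using card_incident_eq_card_nbrs[OF assms] by (simp add: degree_def)

lemma finite_edges:
  assumes "finite_simple_graph G"
  shows "finite (edges G)"
  using assms unfolding finite_simple_graph_def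
  by (metis PowI finite_Pow_iff finite_subset subsetI)

text \<open>Each vertex of \<open>T\<close> needs \<open>a\<close> factor edges. Those leading into
  \<open>S\<close> number at most \<open>b\<close> per vertex of \<open>S\<close>; the rest are
  counted by the sum on the right.\<close>

lemma has_factor_barrier_ineq:
  assumes G: "finite_simple_graph G" and fac: "has_factor a b G"
    and S: "S \<subseteq> verts G" and T: "T \<subseteq> verts G"
  shows "a * card T \<le> b * card S + (\<Sum>t\<in>T. card (nbrs (edges G) t - S))"
proof -
  obtain H where H: "is_factor a b H G"
    using fac by (auto simp: has_factor_def)
  have sub: "edges H \<subseteq> edges G"
    using H by (auto simp: is_factor_def spanning_subgraph_def)
  have finG: "finite (edges G)" and finH: "finite (edges H)"
    using finite_edges[OF G] sub finite_subset by auto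
  have fin: "finite S" "finite T"
    using G S T finite_subset by (auto simp: finite_simple_graph_def)
  have deg: "degree H v = card (nbrs (edges H) v)" for v
    using G sub by (intro degree_eq_card_nbrs) (auto simp: finite_simple_graph_def)
  have "a * card T = (\<Sum>t\<in>T. a)" by simp
  also have "\<dots> \<le> (\<Sum>t\<in>T. card (nbrs (edges H) t))"
    using H T deg by (intro sum_mono) (auto simp: is_factor_def)
  also have "\<dots> = (\<Sum>t\<in>T. card (nbrs (edges H) t \<inter> S)) + (\<Sum>t\<in>T. card (nbrs (edges H) t - S))"
    using card_nbrs_split[OF finH] by (simp flip: sum.distrib)
  also have "(\<Sum>t\<in>T. card (nbrs (edges H) t \<inter> S)) = (\<Sum>s\<in>S. card (nbrs (edges H) s \<inter> T))"
    by (rule sum_card_nbrs_swap[OF fin])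
  also have "\<dots> \<le> (\<Sum>s\<in>S. b)"
  proof (rule sum_mono)
    fix s assume "s \<in> S"
    then have "card (nbrs (edges H) s) \<le> b"
      using H S deg by (auto simp: is_factor_def)
    then show "card (nbrs (edges H) s \<inter> T) \<le> b"
      using card_mono[OF finite_nbrs[OF finH], of "nbrs (edges H) s \<inter> T" s] by auto
  qed
  also have "(\<Sum>t\<in>T. card (nbrs (edges H) t - S)) \<le> (\<Sum>t\<in>T. card (nbrs (edges G) t - S))"
    using finite_nbrs[OF finG] sub by (intro sum_mono card_mono) (auto simp: nbrs_def)
  finally show ?thesis by (simp add: mult.commute)
qed

text \<open>In an optimal subgraph no alternating walk from a deficient vertex \<open>r\<close> can
  be used for augmentation. The vertices on even levels form \<open>T\<close> and those on odd
  levels form \<open>S\<close>; blocked walks make the count tight on both sets.\<close>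

lemma no_factor_barrier:
  assumes G: "finite_simple_graph G" and ab: "a < b" and no: "\<not> has_factor a b G"
  obtains S T where "S \<subseteq> verts G" "T \<subseteq> verts G" "S \<inter> T = {}"
    "b * card S + (\<Sum>t\<in>T. card (nbrs (edges G) t - S)) < a * card T"
proof -
  define E where "E = edges G"
  define V where "V = verts G"
  let ?d = "\<lambda>H v. card (nbrs H v)"
  \<comment> \<open>The cap at \<open>a\<close> prevents a surplus at one vertex from hiding a
    deficit at another.\<close>
  let ?val = "\<lambda>H. \<Sum>v\<in>V. min a (?d H v)"
  have finE: "finite E" and finV: "finite V"
    using finite_edges[OF G] G by (auto simp: E_def V_def finite_simple_graph_def)
  have card2: "card e = 2" and eV: "e \<subseteq> V" if "e \<in> E" for e
    using G that by (auto simp: finite_simple_graph_def E_def V_def)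
  \<comment> \<open>This makes the degree bound over the whole type in \<open>adm\<close> harmless,
    and puts every vertex whose capped degree rises into \<open>V\<close>.\<close>
  have outside: "?d H v = 0" if "H \<subseteq> E" "v \<notin> V" for H v
  proof -
    have "nbrs H v = {}" using that eV by (fastforce simp: nbrs_def)
    then show ?thesis by simp
  qed
  define adm where "adm H \<longleftrightarrow> H \<subseteq> E \<and> (\<forall>v. ?d H v \<le> b)" for H
  have "adm {}" by (simp add: adm_def nbrs_def)
  moreover have "?val H < Suc (a * card V)" for H
  proof -
    have "?val H \<le> (\<Sum>v\<in>V. a)" by (rule sum_mono) simp
    then show ?thesis by (simp add: mult.commute)
  qed
  ultimately have "\<exists>H. adm H \<and> (\<forall>H'. adm H' \<longrightarrow> ?val H' \<le> ?val H)"
    by (intro ex_has_greatest_nat[of adm "{}" ?val "Suc (a * card V)"]) auto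
  then obtain H where H: "adm H" and opt: "\<And>H'. adm H' \<Longrightarrow> ?val H' \<le> ?val H"
    by blast
  have HE: "H \<subseteq> E" and Hb: "?d H v \<le> b" for v
    using H by (auto simp: adm_def)
  have finH: "finite H" using HE finE finite_subset by blast
  have "\<exists>r\<in>V. ?d H r < a"
  proof (rule ccontr)
    assume "\<not> ?thesis"
    moreover have "degree \<lparr>verts = V, edges = H\<rparr> v = ?d H v" for v
      using HE card2 by (subst degree_eq_card_nbrs) auto
    ultimately have "is_factor a b \<lparr>verts = V, edges = H\<rparr> G"
      using HE Hb by (auto simp: is_factor_def spanning_subgraph_def V_def E_def not_less)
    then show False using no by (auto simp: has_factor_def)
  qed
  then obtain r where r: "r \<in> V" "?d H r < a" by blast
  have no_bad: "\<not> (if even n then a < ?d H v else ?d H v < b)" if lev: "v \<in> alt_level E H r n" for n v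
  proof
    assume bad: "if even n then a < ?d H v else ?d H v < b"
    then obtain H' w where H': "H' \<subseteq> E" "\<And>v. ?d H' v \<le> b"
      and le: "\<And>v. min a (?d H v) \<le> min a (?d H' v)" and lt: "min a (?d H w) < min a (?d H' w)"
      using alternating_augment[OF finE card2 ab HE Hb r(2) lev bad] by blast
    have "w \<in> V" using lt outside[OF H'(1)] by force
    then have "?val H < ?val H'"
      using le lt finV by (intro sum_strict_mono_ex1) auto
    then show False using opt[of H'] H' by (auto simp: adm_def)
  qed
  define T where "T = {v. \<exists>n. even n \<and> v \<in> alt_level E H r n}"
  define S where "S = {v. \<exists>n. odd n \<and> v \<in> alt_level E H r n}"
  have dT: "?d H v \<le> a" if "v \<in> T" for v
  proof -
    obtain n where "even n" "v \<in> alt_level E H r n" using \<open>v \<in> T\<close> by (auto simp: T_def)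
    then show ?thesis using no_bad[of v n] by simp
  qed
  have dS: "b \<le> ?d H v" if "v \<in> S" for v
  proof -
    obtain n where "odd n" "v \<in> alt_level E H r n" using \<open>v \<in> S\<close> by (auto simp: S_def)
    then show ?thesis using no_bad[of v n] by simp
  qed
  have disj: "S \<inter> T = {}"
  proof (rule ccontr)
    assume "S \<inter> T \<noteq> {}"
    then obtain v where "v \<in> S" "v \<in> T" by blast
    then show False using dS[of v] dT[of v] ab by simp
  qed
  have "r \<in> alt_level E H r 0" by simp
  then have rT: "r \<in> T" unfolding T_def using even_zero by blast
  \<comment> \<open>A non-\<open>H\<close> edge extends an even walk to an odd level; dually, an
    \<open>H\<close> edge extends an odd walk to an even level.\<close>
  have TS: "w \<in> S" if "v \<in> T" "{v, w} \<in> E - H" for v w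
  proof -
    obtain n where "even n" "v \<in> alt_level E H r n" using \<open>v \<in> T\<close> by (auto simp: T_def)
    then have "odd (Suc n)" "w \<in> alt_level E H r (Suc n)" using that(2) by auto
    then show ?thesis unfolding S_def by blast
  qed
  have ST: "w \<in> T" if "v \<in> S" "{v, w} \<in> H" for v w
  proof -
    obtain n where "odd n" "v \<in> alt_level E H r n" using \<open>v \<in> S\<close> by (auto simp: S_def)
    then have "even (Suc n)" "w \<in> alt_level E H r (Suc n)" using that(2) by auto
    then show ?thesis unfolding T_def by blast
  qed
  have lev_V: "alt_level E H r n \<subseteq> V" for n
  proof (cases n)
    case (Suc m)
    show ?thesis
    proof
      fix w assume "w \<in> alt_level E H r n"
      then obtain u where "{u, w} \<in> E" using Suc HE by (auto split: if_splits)
      then show "w \<in> V" using eV by blast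
    qed
  qed (use r in simp)
  then have sub: "S \<subseteq> V" "T \<subseteq> V" by (auto simp: S_def T_def)
  then have fin: "finite S" "finite T" using finV finite_subset by auto
  have "b * card S = (\<Sum>s\<in>S. b)" by simp
  also have "\<dots> \<le> (\<Sum>s\<in>S. card (nbrs H s \<inter> T))"
  proof (rule sum_mono)
    fix s assume s: "s \<in> S"
    then have "nbrs H s \<inter> T = nbrs H s" using ST by (auto simp: nbrs_def)
    then show "b \<le> card (nbrs H s \<inter> T)" using dS[OF s] by simp
  qed
  also have "\<dots> = (\<Sum>t\<in>T. card (nbrs H t \<inter> S))"
    by (rule sum_card_nbrs_swap[OF fin, symmetric])
  finally have 1: "b * card S \<le> (\<Sum>t\<in>T. card (nbrs H t \<inter> S))" .
  \<comment> \<open>By \<open>TS\<close>, every edge from \<open>T\<close> to a vertex outside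
    \<open>S\<close> belongs to \<open>H\<close>.\<close>
  have 2: "(\<Sum>t\<in>T. card (nbrs E t - S)) \<le> (\<Sum>t\<in>T. card (nbrs H t - S))"
    using TS finite_nbrs[OF finH] by (intro sum_mono card_mono) (auto simp: nbrs_def)
  have "(\<Sum>t\<in>T. card (nbrs H t \<inter> S)) + (\<Sum>t\<in>T. card (nbrs H t - S)) = (\<Sum>t\<in>T. ?d H t)"
    using card_nbrs_split[OF finH] by (simp flip: sum.distrib)
  \<comment> \<open>Strictness comes from the deficient vertex \<open>r \<in> T\<close>.\<close>
  also have "\<dots> < (\<Sum>t\<in>T. a)"
    using dT r(2) rT fin by (intro sum_strict_mono_ex1) auto
  finally have "b * card S + (\<Sum>t\<in>T. card (nbrs E t - S)) < a * card T"
    using 1 2 by (simp add: mult.commute)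
  then show ?thesis
    using that[of S T] sub disj by (simp add: E_def V_def)
qed

section \<open>From deleting an edge to deleting two vertices\<close>

text \<open>Restoring \<open>e\<close> gives each of its two ends at most one more
  neighbour.\<close>

lemma sum_card_nbrs_remove_edge_le:
  assumes "finite F" "finite T" "card e = 2"
  shows "(\<Sum>t\<in>T. card (nbrs F t - S)) \<le> (\<Sum>t\<in>T. card (nbrs (F - {e}) t - S)) + 2"
proof -
  obtain u v where e: "e = {u, v}" "u \<noteq> v"
    using assms(3) by (auto simp: card_2_iff)
  have "card (nbrs F t - S) \<le> card (nbrs (F - {e}) t - S) + (if t \<in> e then 1 else 0)" for t
  proof -
    let ?D = "if t = u then {v} else if t = v then {u} else {}"
    have "nbrs F t - S \<subseteq> (nbrs (F - {e}) t - S) \<union> ?D"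
      using e by (auto simp: nbrs_def doubleton_eq_iff)
    then have "card (nbrs F t - S) \<le> card ((nbrs (F - {e}) t - S) \<union> ?D)"
      using assms(1) by (intro card_mono) (auto simp: finite_nbrs)
    also have "\<dots> \<le> card (nbrs (F - {e}) t - S) + card ?D"
      by (rule card_Un_le)
    finally show ?thesis using e by (auto split: if_splits)
  qed
  then have "(\<Sum>t\<in>T. card (nbrs F t - S))
      \<le> (\<Sum>t\<in>T. card (nbrs (F - {e}) t - S) + (if t \<in> e then 1 else 0))"
    by (intro sum_mono)
  also have "\<dots> = (\<Sum>t\<in>T. card (nbrs (F - {e}) t - S)) + card (T \<inter> e)"
    using assms(2) by (simp add: sum.distrib sum.If_cases)
  also have "card (T \<inter> e) \<le> 2"
    using assms(3) card_mono[of e "T \<inter> e"] e by auto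
  finally show ?thesis by simp
qed

theorem theorem8:
  fixes a b :: nat and G :: "'a ugraph"
  assumes "1 \<le> a" and "a < b"
    and "finite_simple_graph G"
    and "min_degree G \<ge> a + 2"
    and "\<And>x y. x \<in> verts G \<Longrightarrow> y \<in> verts G \<Longrightarrow> x \<noteq> y \<Longrightarrow>
           has_factor a b (delete_verts G {x, y})"
  shows "\<forall>e\<in>edges G. has_factor a b (delete_edge G e)"
proof (rule ballI, rule ccontr)
  fix e assume e: "e \<in> edges G" and no: "\<not> has_factor a b (delete_edge G e)"
  let ?F = "edges G - {e}"
  have finE: "finite (edges G)" and finV: "finite (verts G)"
    using finite_edges[OF assms(3)] assms(3) by (auto simp: finite_simple_graph_def)
  have card2: "card f = 2" if "f \<in> edges G" for f
    using assms(3) that by (auto simp: finite_simple_graph_def)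
  have "finite_simple_graph (delete_edge G e)"
    using assms(3) by (auto simp: finite_simple_graph_def delete_edge_def)
  then obtain S T where S: "S \<subseteq> verts G" and T: "T \<subseteq> verts G"
    and disj: "S \<inter> T = {}"
    and barrier: "b * card S + (\<Sum>t\<in>T. card (nbrs ?F t - S)) < a * card T"
    using no_factor_barrier[OF _ assms(2) no] by (auto simp: delete_edge_def)
  have fin: "finite S" "finite T"
    using S T finV finite_subset by auto
  have "\<exists>t\<in>T. card (nbrs ?F t - S) < a"
  proof (rule ccontr)
    assume "\<not> ?thesis"
    then have "(\<Sum>t\<in>T. a) \<le> (\<Sum>t\<in>T. card (nbrs ?F t - S))"
      by (intro sum_mono) (simp add: not_less)
    then show False using barrier by (simp add: mult.commute)
  qed
  then obtain t where t: "t \<in> T" "card (nbrs ?F t - S) < a" by blast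
  \<comment> \<open>The vertex \<open>t\<close> shows that \<open>verts G\<close> is nonempty, so
    the \<open>Min\<close> is a genuine minimum.\<close>
  have "min_degree G \<le> degree G t"
    using t(1) T finV by (auto simp: min_degree_def)
  then have "a + 2 \<le> card (nbrs (edges G) t)"
    using assms(4) degree_eq_card_nbrs[of G t] card2 by simp
  moreover obtain u v where uv: "e = {u, v}" "u \<noteq> v"
    using card2[OF e] by (auto simp: card_2_iff)
  then have "card (nbrs (edges G) t) \<le> card (nbrs ?F t) + 1"
    using card_nbrs_remove[OF finE, of u v t] e by simp
  \<comment> \<open>At least \<open>a + 1\<close> neighbours remain without \<open>e\<close>, and at
    most \<open>a - 1\<close> of them lie outside \<open>S\<close>.\<close>
  ultimately have "2 \<le> card (nbrs ?F t \<inter> S)"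
    using t(2) card_nbrs_split[of ?F t S] finE by simp
  also have "\<dots> \<le> card S"
    using fin by (intro card_mono) auto
  finally have "2 \<le> card S" .
  then obtain X where "X \<subseteq> S" "card X = 2"
    by (metis obtain_subset_with_card_n)
  then obtain x y where xy: "x \<in> S" "y \<in> S" "x \<noteq> y"
    by (auto simp: card_2_iff)
  let ?G' = "delete_verts G {x, y}"
  let ?S' = "S - {x, y}"
  have "finite_simple_graph ?G'"
    using assms(3) by (auto simp: finite_simple_graph_def delete_verts_def)
  moreover have "has_factor a b ?G'"
    using assms(5)[of x y] xy S by auto
  moreover have "?S' \<subseteq> verts ?G'" "T \<subseteq> verts ?G'"
    using S T disj xy by (auto simp: delete_verts_def)
  ultimately have "a * card T \<le> b * card ?S' + (\<Sum>t\<in>T. card (nbrs (edges ?G') t - ?S'))"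
    by (rule has_factor_barrier_ineq)
  \<comment> \<open>Surviving edges avoid \<open>x\<close> and \<open>y\<close>, so a neighbour
    outside \<open>?S'\<close> is also outside \<open>S\<close>.\<close>
  also have "(\<Sum>t\<in>T. card (nbrs (edges ?G') t - ?S')) \<le> (\<Sum>t\<in>T. card (nbrs (edges G) t - S))"
    using finite_nbrs[OF finE]
    by (intro sum_mono card_mono) (auto simp: nbrs_def delete_verts_def)
  also have "\<dots> \<le> (\<Sum>t\<in>T. card (nbrs ?F t - S)) + 2"
    by (rule sum_card_nbrs_remove_edge_le[OF finE fin(2) card2[OF e]])
  finally have "a * card T \<le> b * card ?S' + (\<Sum>t\<in>T. card (nbrs ?F t - S)) + 2" by simp
  moreover have "card S = card ?S' + 2"
    using xy fin \<open>2 \<le> card S\<close> by (subst card_Diff_subset) auto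
  then have "b * card S = b * card ?S' + 2 * b" by (simp add: algebra_simps)
  \<comment> \<open>Together with \<open>barrier\<close> this would give \<open>2 * b < 2\<close>,
    but \<open>b > a \<ge> 1\<close>.\<close>
  ultimately show False
    using barrier assms(1,2) by simp
qed

end
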